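(* Let $d$ and $m$ be positive integers and let $P$ be a rank $d$ rational Dyck positroid on the ground set $[d+m]$. The positroid cell $S_P^+$ inside the cell decomposition of the totally nonnegative Grassmannian $(\mathrm{Gr}_{d,d+m})_{\ge0}$ into positroid cells has dimension $d+m-1$.
   Context: $[n]=\{1,\dots,n\}$. A rational Dyck path of type $(m,d)$ is a lattice path from $(0,0)$ to $(m,d)$ that only uses unit steps $(1,0)$ or $(0,1)$ and never goes above the line $y=(d/m)x$. A $d\times m$ binary matrix $(a_{i,j})$ is a rational Dyck matrix if its zero entries are separated from its one entries by a vertically-reflected rational Dyck path of type $(m,d)$, with the zeros in the upper-right corner; explicitly, there is a rational Dyck path of type $(m,d)$ such that, if $h_j$ is the height ($y$-coordinate) of its $j$-th horizontal step from the left, then $a_{i,j}=0$ if and only if $i\le h_j$. $\mathcal{D}_{d,m}$ denotes the set of all $d\times m$ rational Dyck matrices. The map $\phi_{d,m}\colon \mathrm{Mat}_{d,m}(\mathbb{R})\to \mathrm{Mat}_{d,d+m}(\mathbb{R})$ sends $A=(a_{i,j})$ to the block matrix $(I_d \mid A')$, where $A'$ is the $d\times m$ matrix with $(i,j)$ entry $(-1)^{d-i}a_{d+1-i,j}$. A positroid of rank $d$ on $[n]$ is a matroid represented by a full-rank real $d\times n$ matrix $A$ with nonnegative maximal minors: its bases are the $B\subseteq[n]$ such that the columns of $A$ indexed by $B$ form a basis of $\mathbb{R}^d$. Matrices in $\phi_{d,m}(\mathcal{D}_{d,m})$ have full rank and nonnegative maximal minors; a rank $d$ rational Dyck positroid on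 $[d+m]$ is a positroid represented by a matrix in $\phi_{d,m}(\mathcal{D}_{d,m})$. The real Grassmannian $\mathrm{Gr}_{d,n}$ is the set of $d$-dimensional subspaces of $\mathbb{R}^n$; each element is the row span $[A]$ of a full-rank real $d\times n$ matrix $A$. For $[A]\in\mathrm{Gr}_{d,n}$, $M_{[A]}$ is the rank $d$ matroid on $[n]$ represented by $A$ (independent of the choice of $A$). For a rank $d$ representable matroid $M$ on $[n]$, its matroid stratum is $S_M=\{[A]\in\mathrm{Gr}_{d,n}\mid M_{[A]}=M\}$. The totally nonnegative Grassmannian $(\mathrm{Gr}_{d,n})_{\ge0}$ is the quotient $\mathrm{GL}_d^+(\mathbb{R})\backslash\mathrm{Mat}^+_{d,n}(\mathbb{R})$, where $\mathrm{GL}_d^+(\mathbb{R})$ is the group of real $d\times d$ matrices with positive determinant and $\mathrm{Mat}^+_{d,n}(\mathbb{R})$ is the set of full-rank real $d\times n$ matrices with nonnegative maximal minors; it is regarded as a subset of $\mathrm{Gr}_{d,n}$. For a rank $d$ positroid $P$ on $[n]$, its positroid cell is $S_P^+=S_P\cap(\mathrm{Gr}_{d,n})_{\ge0}$; each positroid cell is a topological (open) cell. *)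

theory Defs
  imports
    "HOL-Analysis.Abstract_Euclidean_Space"
    "Jordan_Normal_Form.DL_Rank"
    "Jordan_Normal_Form.DL_Submatrix"
begin

text \<open>
  Matrices are those of \<open>Jordan_Normal_Form\<close>, so rows, columns and ground sets are indexed from 0:
  the paper's \<open>[n] = {1, \<dots>, n}\<close> is \<open>{..<n}\<close> here, and its index \<open>i\<close> is our \<open>i - 1\<close>.
\<close>

section \<open>Rational Dyck matrices\<close>

datatype step = East | North

text \<open>
  Along a single step the signed height above the line \<open>y = (d/m) x\<close> is monotone, so the path
  stays weakly below the line iff its lattice points, the end points of its prefixes, do.
\<close>

definition rational_dyck_path :: "nat \<Rightarrow> nat \<Rightarrow> step list \<Rightarrow> bool" where
  "rational_dyck_path m d p \<longleftrightarrow>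
     count_list p East = m \<and> count_list p North = d \<and>
     (\<forall>k \<le> length p. real (count_list (take k p) North)
                        \<le> real d / real m * real (count_list (take k p) East))"

text \<open>\<open>horizontal_heights 0 p ! j\<close> is the paper's \<open>h\<^bsub>j+1\<^esub>\<close>.\<close>

fun horizontal_heights :: "nat \<Rightarrow> step list \<Rightarrow> nat list" where
  "horizontal_heights y [] = []"
| "horizontal_heights y (East # p) = y # horizontal_heights y p"
| "horizontal_heights y (North # p) = horizontal_heights (Suc y) p"

text \<open>The condition \<open>i \<le> h\<^sub>j\<close> on 1-based indices becomes a strict inequality.\<close>

definition rational_dyck_matrices :: "nat \<Rightarrow> nat \<Rightarrow> real mat set" where
  "rational_dyck_matrices d m =
     {A \<in> carrier_mat d m.
        elements_mat A \<subseteq> {0, 1} \<and>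
        (\<exists>p. rational_dyck_path m d p \<and>
             (\<forall>i < d. \<forall>j < m. A $$ (i, j) = 0 \<longleftrightarrow> i < horizontal_heights 0 p ! j))}"

text \<open>
  In 1-based indices the right block of \<open>phi d m A\<close> has the entries
  \<open>(-1)\<^bsup>d-i\<^esup> a\<^bsub>d+1-i,j\<^esub>\<close>; replacing \<open>i\<close> by \<open>i + 1\<close> gives both exponent and row index
  \<open>d - 1 - i\<close>.  The lower blocks have no rows.
\<close>

definition phi :: "nat \<Rightarrow> nat \<Rightarrow> real mat \<Rightarrow> real mat" where
  "phi d m A =
     four_block_mat
       (1\<^sub>m d) (mat d m (\<lambda>(i, j). (- 1) ^ (d - 1 - i) * A $$ (d - 1 - i, j)))
       (0\<^sub>m 0 d) (0\<^sub>m 0 m)"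


section \<open>Represented matroids and positroids\<close>

text \<open>A matroid is given by its ground set and its set of bases.\<close>

type_synonym matroid = "nat set \<times> nat set set"

definition full_rank_mats :: "nat \<Rightarrow> nat \<Rightarrow> real mat set" where
  "full_rank_mats d n = {A \<in> carrier_mat d n. vec_space.rank d A = d}"

text \<open>
  Injectivity is needed since \<open>basis\<close> speaks about sets of vectors: two equal columns are
  dependent as a family.
\<close>

definition represented_matroid :: "real mat \<Rightarrow> matroid" where
  "represented_matroid A =
     ({..<dim_col A},
      {B. B \<subseteq> {..<dim_col A} \<and> inj_on (col A) B \<and>
          vectorspace.basis class_ring (module_vec TYPE(real) (dim_row A)) (col A ` B)})"

definition nonneg_mats :: "nat \<Rightarrow> nat \<Rightarrow> real mat set" where
  "nonneg_mats d n =
     {A \<in> full_rank_mats d n. \<forall>B \<subseteq> {..<n}. card B = d \<longrightarrow> 0 \<le> det (submatrix A {..<d} B)}"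

definition positroid :: "nat \<Rightarrow> nat \<Rightarrow> matroid \<Rightarrow> bool" where
  "positroid d n P \<longleftrightarrow> (\<exists>A \<in> nonneg_mats d n. P = represented_matroid A)"

definition rational_dyck_positroid :: "nat \<Rightarrow> nat \<Rightarrow> matroid \<Rightarrow> bool" where
  "rational_dyck_positroid d m P \<longleftrightarrow>
     positroid d (d + m) P \<and> (\<exists>A \<in> phi d m ` rational_dyck_matrices d m. P = represented_matroid A)"


section \<open>The Grassmannian and its totally nonnegative part\<close>

definition grassmannian :: "nat \<Rightarrow> nat \<Rightarrow> real vec set set" where
  "grassmannian d n =
     {W. VectorSpace.subspace class_ring W (module_vec TYPE(real) n) \<and>
         vectorspace.dim class_ring ((module_vec TYPE(real) n)\<lparr>carrier := W\<rparr>) = d}"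

abbreviation row_span :: "nat \<Rightarrow> real mat \<Rightarrow> real vec set" where
  "row_span n A \<equiv> vec_space.row_space n A"

text \<open>The usual topology of \<open>\<real>\<^bsup>d \<times> n\<^esup>\<close>, transported to the carrier of the \<open>d \<times> n\<close> matrices.\<close>

definition mat_topology :: "nat \<Rightarrow> nat \<Rightarrow> real mat topology" where
  "mat_topology d n =
     pullback_topology (carrier_mat d n) (\<lambda>A. \<lambda>ij \<in> {..<d} \<times> {..<n}. A $$ ij)
       (product_topology (\<lambda>_. euclideanreal) ({..<d} \<times> {..<n}))"

text \<open>The quotient topology for the map sending a full-rank matrix to its row span.\<close>

definition grassmannian_topology :: "nat \<Rightarrow> nat \<Rightarrow> real vec set topology" where
  "grassmannian_topology d n =
     topology (\<lambda>U. U \<subseteq> grassmannian d n \<and>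
       openin (subtopology (mat_topology d n) (full_rank_mats d n))
              {A \<in> full_rank_mats d n. row_span n A \<in> U})"

definition matroid_stratum :: "nat \<Rightarrow> nat \<Rightarrow> matroid \<Rightarrow> real vec set set" where
  "matroid_stratum d n M =
     {V \<in> grassmannian d n.
        \<exists>A \<in> full_rank_mats d n. V = row_span n A \<and> represented_matroid A = M}"

text \<open>
  Full-rank matrices with the same row span and nonnegative maximal minors differ by a left factor
  of positive determinant, so the quotient of \<open>nonneg_mats d n\<close> by that group embeds into the
  Grassmannian with the following image.
\<close>

definition nonneg_grassmannian :: "nat \<Rightarrow> nat \<Rightarrow> real vec set set" where
  "nonneg_grassmannian d n = row_span n ` nonneg_mats d n"

definition nonneg_grassmannian_topology :: "nat \<Rightarrow> nat \<Rightarrow> real vec set topology" where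
  "nonneg_grassmannian_topology d n =
     subtopology (grassmannian_topology d n) (nonneg_grassmannian d n)"

definition positroid_cell :: "nat \<Rightarrow> nat \<Rightarrow> matroid \<Rightarrow> real vec set set" where
  "positroid_cell d n P = matroid_stratum d n P \<inter> nonneg_grassmannian d n"

text \<open>The \<open>k\<close> below is unique by invariance of dimension.\<close>

definition open_cell_of_dim :: "nat \<Rightarrow> 'a topology \<Rightarrow> bool" where
  "open_cell_of_dim k X \<longleftrightarrow> X homeomorphic_space Euclidean_space k"


text \<open>The family defining \<open>grassmannian_topology\<close> is a topology, so its open sets are as intended:\<close>

lemma istopology_quotient:
  "istopology (\<lambda>U. U \<subseteq> S \<and> openin X {A \<in> F. f A \<in> U})" if "topspace X = F"
proof -
  have "openin X {A \<in> F. f A \<in> U \<inter> V}"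
    if "openin X {A \<in> F. f A \<in> U}" "openin X {A \<in> F. f A \<in> V}" for U V
  proof -
    have "{A \<in> F. f A \<in> U \<inter> V} = {A \<in> F. f A \<in> U} \<inter> {A \<in> F. f A \<in> V}" by auto
    with that show ?thesis by auto
  qed
  moreover have "openin X {A \<in> F. f A \<in> \<Union>K}" if "\<forall>U \<in> K. openin X {A \<in> F. f A \<in> U}" for K
  proof -
    have "{A \<in> F. f A \<in> \<Union>K} = (\<Union>U \<in> K. {A \<in> F. f A \<in> U})" by auto
    with that show ?thesis by auto
  qed
  ultimately show ?thesis unfolding istopology_def by blast
qed

lemma topspace_mat_topology: "topspace (mat_topology d n) = carrier_mat d n"
  unfolding mat_topology_def topspace_pullback_topology by auto

lemma openin_grassmannian_topology:
  "openin (grassmannian_topology d n) U \<longleftrightarrow>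
     U \<subseteq> grassmannian d n \<and>
     openin (subtopology (mat_topology d n) (full_rank_mats d n))
            {A \<in> full_rank_mats d n. row_span n A \<in> U}"
  unfolding grassmannian_topology_def
  by (subst topology_inverse'[OF istopology_quotient])
     (auto simp: topspace_mat_topology full_rank_mats_def)

end

theory Submission
  imports Defs "Jordan_Normal_Form.DL_Rank_Submatrix"
begin

text \<open>
  Every point of the cell of \<open>P\<close> is the row span of a unique matrix \<open>(I | C)\<close>, because the first \<open>d\<close>
  columns form a basis of \<open>P\<close>.  Let \<open>(I | C0)\<close> be the image under \<^const>\<open>phi\<close> of a rational Dyck matrix
  representing \<open>P\<close>.  Up to signs depending only on the row, \<open>C0\<close> has entries in \<open>{0, 1}\<close>, and its
  first row and first column contain no zeros (\<open>rational_dyck_matrix_hook\<close>).  The claim is that the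
  admissible \<open>C\<close> are exactly the matrices \<open>r\<^sub>i c\<^sub>j C0\<^sub>i\<^sub>j\<close> with positive \<open>r\<^sub>i\<close> and \<open>c\<^sub>j\<close>.

  Minors that replace one column of the identity block by a column of \<open>C\<close> are the entries of \<open>C\<close> up
  to sign, so \<open>C\<close> has the zeros and the signs of \<open>C0\<close> (\<open>minor_exchange\<close>).  Minors that replace two
  columns vanish iff the corresponding \<open>2 \<times> 2\<close> minors of \<open>C\<close> do, so the same \<open>2 \<times> 2\<close>
  minors vanish for \<open>C\<close> and \<open>C0\<close> (\<open>double_exchange_minor_zero_iff\<close>).  Hence each nonzero entry is determined by the first row
  and the first column, and \<open>C\<close> is a positive rescaling of \<open>C0\<close> (\<open>rank_one_on_pattern\<close>).  Conversely,
  positive rescaling of rows and columns changes neither the signs of minors nor the matroid.  The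
  nonnegativity of the minors of \<open>(I | C0)\<close> itself follows in the same way from the existence of some
  nonnegative matrix representing \<open>P\<close> (\<open>positroid_cell_eq\<close>).

  The absolute values of the \<open>d + m - 1\<close> entries in the first row and first column of \<open>C\<close> are thus
  free positive parameters, and their logarithms identify the cell with Euclidean space
  (\<open>cell_is_open_cell\<close>).  This bijection is continuous in both directions for the quotient topology of
  the Grassmannian: the row spans of matrices with invertible left block form an open set, on which
  the entries of \<open>C\<close> are quotients of determinants by Cramer's rule
  (\<open>openin_plane_coord_preimage\<close>).
\<close>

section \<open>Minors and represented matroids\<close>

lemma pick_lessThan:
  assumes "i < d"
  shows "pick {..<d} i = i"
proof -
  have "{a \<in> {..<d}. a < i} = {..<i}" using assms by auto
  then show ?thesis using pick_card_in_set[of i "{..<d}"] assms by simp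
qed

text \<open>
  A maximal minor uses every row and \<open>d\<close> columns; its submatrix is square, with the columns
  enumerated increasingly by \<^const>\<open>pick\<close>.
\<close>

lemma submatrix_all_rows:
  assumes A: "A \<in> carrier_mat d n" and B: "B \<subseteq> {..<n}" "card B = d"
  shows "submatrix A {..<d} B = mat d d (\<lambda>(i, k). A $$ (i, pick B k))"
proof -
  have 1: "{i. i < d \<and> i \<in> {..<d}} = {..<d}" "{j. j < n \<and> j \<in> B} = B"
    using B by auto
  show ?thesis
    using A B 1 by (intro eq_matI) (simp_all add: submatrix_def pick_lessThan)
qed

lemma pick_bij_betw:
  assumes "finite B"
  shows "bij_betw (pick B) {..<card B} B"
proof -
  have "inj_on (pick B) {..<card B}"
    by (metis (no_types, lifting) inj_onI lessThan_iff linorder_neqE_nat pick_mono_le less_irrefl)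
  moreover have "pick B ` {..<card B} \<subseteq> B" using pick_in_set_le by auto
  ultimately show ?thesis using assms
    by (metis bij_betw_def card_image card_lessThan card_subset_eq)
qed

lemma col_submatrix_all_rows:
  assumes A: "A \<in> carrier_mat d n" and B: "B \<subseteq> {..<n}" "card B = d" and k: "k < d"
  shows "col (submatrix A {..<d} B) k = col A (pick B k)"
proof -
  have "pick B k \<in> B" using pick_in_set_le k B by auto
  then show ?thesis unfolding submatrix_all_rows[OF A B]
    using A B k by (auto intro!: eq_vecI)
qed

text \<open>
  A square matrix has nonzero determinant iff its columns are distinct and independent, and \<open>d\<close>
  independent vectors of a \<open>d\<close>-dimensional space form a basis.  This turns every statement about
  represented matroids into one about vanishing minors.
\<close>

lemma basis_iff_minor_nonzero:
  assumes A: "A \<in> carrier_mat d n" and B: "B \<subseteq> {..<n}"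
  shows "inj_on (col A) B \<and>
      vectorspace.basis class_ring (module_vec TYPE(real) d) (col A ` B) \<longleftrightarrow>
      card B = d \<and> det (submatrix A {..<d} B) \<noteq> 0"  (is "?L \<longleftrightarrow> ?R")
proof -
  interpret V: vec_space "TYPE(real)" d .
  have fin: "finite B" using B finite_subset by blast
  let ?S = "submatrix A {..<d} B"
  have S: "?S \<in> carrier_mat d d" "cols ?S = map (col A \<circ> pick B) [0..<d]" if "card B = d"
    using submatrix_all_rows[OF A B that] col_submatrix_all_rows[OF A B that]
    by (auto simp: cols_def)
  have set: "set (cols ?S) = col A ` B" and dist: "distinct (cols ?S) \<longleftrightarrow> inj_on (col A) B"
    if "card B = d"
  proof -
    have bij: "bij_betw (pick B) {0..<d} B"
      using pick_bij_betw[OF fin] that by (simp add: atLeast0LessThan)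
    show "set (cols ?S) = col A ` B"
      using bij_betw_imp_surj_on[OF bij] unfolding S(2)[OF that]
      by (metis image_comp list.set_map set_upt)
    show "distinct (cols ?S) \<longleftrightarrow> inj_on (col A) B"
      unfolding S(2)[OF that] distinct_map
      using bij comp_inj_on_iff[of "pick B" "{0..<d}" "col A"] by (auto simp: bij_betw_def)
  qed
  show ?thesis
  proof
    assume L: ?L
    then have "card (col A ` B) = d"
      using V.dim_basis[of "col A ` B"] fin V.dim_is_n by auto
    then have c: "card B = d" using L by (simp add: card_image)
    have "V.lin_indpt (col A ` B)" using L unfolding V.basis_def by auto
    then have "V.rank ?S = d"
      using V.lin_indpt_full_rank[OF S(1)[OF c]] L set[OF c] dist[OF c] by simp
    then show ?R using c V.det_rank_iff[OF S(1)[OF c]] by simp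
  next
    assume R: ?R
    then have c: "card B = d" by simp
    have r: "V.rank ?S = d" using R V.det_rank_iff[OF S(1)[OF c]] by simp
    then have "distinct (cols ?S)" using V.non_distinct_low_rank[OF S(1)[OF c]] by auto
    with V.full_rank_lin_indpt[OF S(1)[OF c] r]
    have "V.lin_indpt (col A ` B)" and inj: "inj_on (col A) B" using set[OF c] dist[OF c] by auto
    moreover have "col A ` B \<subseteq> carrier_vec d" using A by auto
    ultimately have "V.basis (col A ` B)"
      using V.dim_li_is_basis[of "col A ` B"] fin c by (simp add: card_image V.dim_is_n)
    then show ?L using inj by simp
  qed
qed

lemma represented_matroid_eq_minors:
  assumes A: "A \<in> carrier_mat d n"
  shows "represented_matroid A =
    ({..<n}, {B. B \<subseteq> {..<n} \<and> card B = d \<and> det (submatrix A {..<d} B) \<noteq> 0})"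
proof -
  have "dim_row A = d" "dim_col A = n" using A by auto
  then show ?thesis unfolding represented_matroid_def using basis_iff_minor_nonzero[OF A] by auto
qed

lemma full_rank_if_minor_nonzero:
  assumes A: "A \<in> carrier_mat d n" and B: "B \<subseteq> {..<n}" "card B = d" "det (submatrix A {..<d} B) \<noteq> 0"
  shows "A \<in> full_rank_mats d n"
proof -
  interpret V: vec_space "TYPE(real)" d .
  have "{j. j < n \<and> j \<in> B} = B" using B by auto
  then have "d \<le> V.rank A" using V.rank_gt_minor[OF A B(3)] B by simp
  moreover have "V.rank A \<le> d"
  proof -
    obtain S where S: "maximal S (\<lambda>T. T \<subseteq> set (cols A) \<and> V.lin_indpt T)"
      using maximal_exists_superset[of "set (cols A)" "\<lambda>T. T \<subseteq> set (cols A) \<and> V.lin_indpt T" "{}"]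
      by (metis (no_types, lifting) List.finite_set V.lindep_span empty_iff empty_subsetI V.finite_lin_indpt2 finite.emptyI)
    have "S \<subseteq> carrier_vec d" "V.lin_indpt S" "finite S"
      using S cols_dim[of A] A finite_subset[of S "set (cols A)"] unfolding maximal_def by auto
    then have "card S \<le> d" using V.li_le_dim(2)[of S] V.dim_is_n by simp
    then show ?thesis using V.rank_card_indpt[OF A S] by simp
  qed
  ultimately show ?thesis using A by (simp add: full_rank_mats_def)
qed

text \<open>
  Singularity of the selected columns, expressed by a row vector orthogonal to all of them.
  Unlike the determinant, this does not depend on the order of the columns, so it yields vanishing
  conditions without sign bookkeeping.
\<close>

lemma minor_zero_iff_annihilated:
  fixes A :: "real mat"
  assumes A: "A \<in> carrier_mat d n" and B: "B \<subseteq> {..<n}" "card B = d"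
  shows "det (submatrix A {..<d} B) = 0 \<longleftrightarrow>
    (\<exists>v. (\<exists>i<d. v i \<noteq> 0) \<and> (\<forall>b\<in>B. (\<Sum>i<d. v i * A $$ (i, b)) = 0))"
proof -
  let ?S = "submatrix A {..<d} B"
  have S: "?S \<in> carrier_mat d d" and St: "?S\<^sup>T \<in> carrier_mat d d"
    using submatrix_all_rows[OF A B] by auto
  have img: "pick B ` {..<d} = B" and fin: "finite B"
    using pick_bij_betw[of B] B finite_subset[of B "{..<n}"] by (auto simp: bij_betw_def)
  have pk: "pick B k < n" if "k < d" for k using img B that by blast
  have mv: "(?S\<^sup>T *\<^sub>v v) $ k = (\<Sum>i<d. v $ i * A $$ (i, pick B k))"
    if "k < d" "v \<in> carrier_vec d" for v k
  proof -
    have "row ?S\<^sup>T k = col A (pick B k)"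
      using that col_submatrix_all_rows[OF A B] S by (simp add: row_transpose)
    then show ?thesis using that S A pk[of k]
      by (auto simp: scalar_prod_def atLeast0LessThan mult.commute intro!: sum.cong)
  qed
  have ev: "?S\<^sup>T *\<^sub>v v = 0\<^sub>v d \<longleftrightarrow> (\<forall>b\<in>B. (\<Sum>i<d. v $ i * A $$ (i, b)) = 0)"
    if "v \<in> carrier_vec d" for v
  proof -
    have "?S\<^sup>T *\<^sub>v v = 0\<^sub>v d \<longleftrightarrow> (\<forall>k<d. (?S\<^sup>T *\<^sub>v v) $ k = 0)"
      using S by (auto simp: vec_eq_iff)
    also have "\<dots> \<longleftrightarrow> (\<forall>b \<in> pick B ` {..<d}. (\<Sum>i<d. v $ i * A $$ (i, b)) = 0)"
      using mv that by auto
    finally show ?thesis using img by simp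
  qed
  have "det ?S = 0 \<longleftrightarrow> (\<exists>v. v \<in> carrier_vec d \<and> v \<noteq> 0\<^sub>v d \<and> ?S\<^sup>T *\<^sub>v v = 0\<^sub>v d)"
    using det_0_iff_vec_prod_zero_field[OF St] det_transpose[OF S] by simp
  also have "\<dots> \<longleftrightarrow> (\<exists>v. (\<exists>i<d. v i \<noteq> 0) \<and> (\<forall>b\<in>B. (\<Sum>i<d. v i * A $$ (i, b)) = 0))"
    (is "?X \<longleftrightarrow> ?Y")
  proof
    assume ?X
    then obtain v where v: "v \<in> carrier_vec d" "v \<noteq> 0\<^sub>v d" "?S\<^sup>T *\<^sub>v v = 0\<^sub>v d" by blast
    then have "\<exists>i<d. v $ i \<noteq> 0" by (auto simp: vec_eq_iff)
    then show ?Y using ev[OF v(1)] v(3) by (intro exI[of _ "\<lambda>i. v $ i"]) auto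
  next
    assume ?Y
    then obtain v where v: "\<exists>i<d. v i \<noteq> 0" "\<forall>b\<in>B. (\<Sum>i<d. v i * A $$ (i, b)) = 0" by blast
    have w: "vec d v \<in> carrier_vec d" "vec d v \<noteq> 0\<^sub>v d" using v(1) by (auto simp: vec_eq_iff)
    have "?S\<^sup>T *\<^sub>v vec d v = 0\<^sub>v d" unfolding ev[OF w(1)] using v(2) by simp
    then show ?X using w by blast
  qed
  finally show ?thesis .
qed

lemma submatrix_mult_left:
  assumes G: "G \<in> carrier_mat d d" and A: "A \<in> carrier_mat d n" and B: "B \<subseteq> {..<n}" "card B = d"
  shows "submatrix (G * A) {..<d} B = G * submatrix A {..<d} B"
proof -
  have "pick B k < n" if "k < d" for k using that pick_in_set_le[of k B] B by auto
  moreover have GA: "G * A \<in> carrier_mat d n" using G A by simp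
  ultimately show ?thesis unfolding submatrix_all_rows[OF GA B] submatrix_all_rows[OF A B]
    using G A by (intro eq_matI) (auto simp: scalar_prod_def)
qed

text \<open>
  Rescaling rows and columns multiplies each minor by the product of the factors involved.  With
  positive factors, both the matroid and the signs of the minors are preserved.
\<close>

lemma minor_rescale:
  fixes A :: "real mat"
  assumes A: "A \<in> carrier_mat d n" and A': "A' \<in> carrier_mat d n" and B: "B \<subseteq> {..<n}" "card B = d"
    and sc: "\<And>i j. i < d \<Longrightarrow> j < n \<Longrightarrow> A' $$ (i, j) = r i * s j * A $$ (i, j)"
  shows "det (submatrix A' {..<d} B) = (\<Prod>i<d. r i) * (\<Prod>b\<in>B. s b) * det (submatrix A {..<d} B)"
proof -
  have bij: "bij_betw (pick B) {..<d} B" using pick_bij_betw[of B] B finite_subset[of B "{..<n}"] by auto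
  have pk: "pick B k < n" if "k < d" for k using that bij B unfolding bij_betw_def by blast
  have *: "(\<Prod>i = 0..<d. A' $$ (i, pick B (p i))) =
     (\<Prod>i<d. r i) * (\<Prod>b\<in>B. s b) * (\<Prod>i = 0..<d. A $$ (i, pick B (p i)))"
    if p: "p permutes {0..<d}" for p
  proof -
    have pi: "p i < d" if "i < d" for i using p that permutes_in_image[OF p, of i] by simp
    have "(\<Prod>i = 0..<d. s (pick B (p i))) = (\<Prod>i = 0..<d. s (pick B i))"
      using prod.permute[OF p, of "\<lambda>i. s (pick B i)"] by (simp add: comp_def)
    also have "\<dots> = (\<Prod>b\<in>B. s b)"
      using prod.reindex_bij_betw[OF bij] by (simp add: atLeast0LessThan)
    finally show ?thesis using sc pk pi
      by (simp add: prod.distrib atLeast0LessThan)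
  qed
  show ?thesis
    unfolding submatrix_all_rows[OF A B] submatrix_all_rows[OF A' B] det_def
    by (simp add: sum_distrib_left, rule sum.cong)
      (use * permutes_in_image in \<open>auto simp: algebra_simps\<close>)
qed

section \<open>Row spans and the chart of row spans of identity-block matrices\<close>

text \<open>
  The rows of \<open>B\<close> lie in the row span of \<open>A\<close>; their coefficient vectors form the matrix \<open>G\<close>.
\<close>

lemma row_span_eqD:
  assumes A: "A \<in> carrier_mat d n" and B: "B \<in> carrier_mat d n"
    and eq: "row_span n A = row_span n B"
  shows "\<exists>G \<in> carrier_mat d d. B = G * A"
proof -
  interpret V: vec_space "TYPE(real)" n .
  have "\<exists>y \<in> carrier_vec d. A\<^sup>T *\<^sub>v y = row B i" if i: "i < d" for i
  proof -
    have "row B i \<in> set (rows B)" using B i by (auto simp: rows_def)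
    moreover have "set (rows B) \<subseteq> carrier_vec n" using B rows_carrier by blast
    ultimately have "row B i \<in> V.row_space A"
      unfolding eq unfolding V.row_space_def using V.in_own_span by auto
    then show ?thesis unfolding V.row_space_eq[OF A] using A by auto
  qed
  then obtain y where y: "\<And>i. i < d \<Longrightarrow> y i \<in> carrier_vec d \<and> A\<^sup>T *\<^sub>v y i = row B i" by metis
  define G where "G = mat d d (\<lambda>(i, k). y i $ k)"
  have "B = G * A"
  proof (rule eq_matI)
    fix i j assume "i < dim_row (G * A)" "j < dim_col (G * A)"
    then have ij: "i < d" "j < n" using A by (auto simp: G_def)
    have "B $$ (i, j) = row B i $ j" using ij B by simp
    also have "\<dots> = (A\<^sup>T *\<^sub>v y i) $ j" using y ij by simp
    also have "\<dots> = (\<Sum>k<d. y i $ k * A $$ (k, j))"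
    proof -
      have "(A\<^sup>T *\<^sub>v z) $ j = (\<Sum>k<d. z $ k * A $$ (k, j))" if "z \<in> carrier_vec d" for z
        using that ij A by (simp add: scalar_prod_def mult.commute atLeast0LessThan)
      then show ?thesis using y ij by blast
    qed
    also have "\<dots> = (G * A) $$ (i, j)"
      using ij A by (simp add: G_def scalar_prod_def atLeast0LessThan)
    finally show "B $$ (i, j) = (G * A) $$ (i, j)" .
  qed (use A B in \<open>auto simp: G_def\<close>)
  then show ?thesis by (auto simp: G_def)
qed

lemma obtain_inverse_mat:
  fixes G :: "real mat"
  assumes G: "G \<in> carrier_mat d d" and nz: "det G \<noteq> 0"
  obtains H where "H \<in> carrier_mat d d" "G * H = 1\<^sub>m d" "H * G = 1\<^sub>m d"
  using det_non_zero_imp_unit[OF G nz, where b = "()"] by (auto simp: Units_def ring_mat_def)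

lemma row_span_mult_left:
  assumes G: "G \<in> carrier_mat d d" "det G \<noteq> 0" and A: "A \<in> carrier_mat d n"
  shows "row_span n (G * A) = row_span n A"
proof -
  have "invertible_mat G"
    using obtain_inverse_mat[OF G] G(1)
    by (metis carrier_matD invertible_mat_def inverts_mat_def square_mat.simps)
  then show ?thesis using vec_space.row_space_is_preserved[OF _ G(1) A] by blast
qed

text \<open>
  The block matrix \<open>(I | C)\<close>.  Its right block is given as a function on indices, so that
  rescalings and parametrizations of \<open>C\<close> can be written entry by entry.
\<close>

definition chart_mat :: "nat \<Rightarrow> nat \<Rightarrow> (nat \<Rightarrow> nat \<Rightarrow> real) \<Rightarrow> real mat" where
  "chart_mat d m C =
     mat d (d + m) (\<lambda>(i, j). if j < d then (if i = j then 1 else 0) else C i (j - d))"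

abbreviation left_block :: "nat \<Rightarrow> real mat \<Rightarrow> real mat" where
  "left_block d A \<equiv> submatrix A {..<d} {..<d}"

text \<open>
  Cramer's rule for the entry \<open>(i, j)\<close> of the right block of \<open>L\<inverse>A\<close>, where \<open>L\<close> is the left block
  of \<open>A\<close>.  As a quotient of polynomials in the entries of \<open>A\<close> it is visibly continuous where
  \<open>det L \<noteq> 0\<close>, and it is unchanged when \<open>A\<close> is multiplied on the left by an invertible matrix.
\<close>

definition chart_coord :: "nat \<Rightarrow> nat \<Rightarrow> nat \<Rightarrow> real mat \<Rightarrow> real" where
  "chart_coord d i j A = det (replace_col (left_block d A) (col A (d + j)) i) / det (left_block d A)"

lemma chart_mat_carrier [simp]: "chart_mat d m C \<in> carrier_mat d (d + m)"
  by (simp add: chart_mat_def)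

lemma left_block_eq:
  assumes "A \<in> carrier_mat d (d + m)"
  shows "left_block d A = mat d d (\<lambda>ij. A $$ ij)"
proof -
  have "left_block d A = mat d d (\<lambda>(i, k). A $$ (i, pick {..<d} k))"
    by (rule submatrix_all_rows[OF assms]) auto
  then show ?thesis by (auto simp: pick_lessThan intro!: eq_matI)
qed

lemma left_block_chart: "left_block d (chart_mat d m C) = 1\<^sub>m d"
  unfolding left_block_eq[OF chart_mat_carrier] by (rule eq_matI) (auto simp: chart_mat_def)

lemma left_block_mult_chart:
  assumes "G \<in> carrier_mat d d"
  shows "left_block d (G * chart_mat d m C) = G"
  using submatrix_mult_left[OF assms chart_mat_carrier, of "{..<d}" m C] assms
  by (simp add: left_block_chart)

lemma factor_through_chart:
  assumes A: "A \<in> carrier_mat d (d + m)" and nz: "det (left_block d A) \<noteq> 0"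
  shows "\<exists>C. A = left_block d A * chart_mat d m C"
proof -
  let ?L = "left_block d A"
  have L: "?L \<in> carrier_mat d d" using left_block_eq[OF A] by simp
  obtain H where H: "H \<in> carrier_mat d d" "?L * H = 1\<^sub>m d" "H * ?L = 1\<^sub>m d"
    using obtain_inverse_mat[OF L nz] by blast
  define C where "C = (\<lambda>i j. (H * A) $$ (i, d + j))"
  have HA: "H * A \<in> carrier_mat d (d + m)" using H A by simp
  have "left_block d (H * A) = 1\<^sub>m d"
    using submatrix_mult_left[OF H(1) A, of "{..<d}"] H(3) by simp
  then have "(H * A) $$ (i, j) = (if i = j then 1 else 0)" if "i < d" "j < d" for i j
    using that left_block_eq[OF HA] by (metis index_mat(1) index_one_mat(1))
  then have "H * A = chart_mat d m C"
    using HA H A by (intro eq_matI) (auto simp: chart_mat_def C_def simp del: index_mult_mat(1))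
  then have "?L * chart_mat d m C = ?L * H * A" using assoc_mult_mat[OF L H(1) A] by simp
  also have "\<dots> = A" using H(2) A by simp
  finally show ?thesis by metis
qed

lemma chart_coord_mult_chart:
  assumes G: "G \<in> carrier_mat d d" and nz: "det G \<noteq> 0" and ij: "i < d" "j < m"
  shows "chart_coord d i j (G * chart_mat d m C) = C i j"
proof -
  let ?x = "vec d (\<lambda>i. C i j)"
  have "col (chart_mat d m C) (d + j) = ?x"
    using ij by (intro eq_vecI) (auto simp: chart_mat_def)
  then have "col (G * chart_mat d m C) (d + j) = G *\<^sub>v ?x"
    using col_mult2[OF G chart_mat_carrier, of "d + j" m C] ij by simp
  then show ?thesis
    using cramer_lemma_mat[OF G, of ?x i] ij nz G
    by (simp add: chart_coord_def left_block_mult_chart)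
qed

text \<open>
  Comparing left blocks: \<open>(I | C) = G A\<close> gives \<open>I = G L\<close> for the left block \<open>L\<close> of \<open>A\<close>, and
  \<open>A = H (I | C)\<close> gives \<open>L = H\<close>.
\<close>

lemma row_span_chartD:
  assumes A: "A \<in> carrier_mat d (d + m)"
    and eq: "row_span (d + m) A = row_span (d + m) (chart_mat d m C)"
  shows "det (left_block d A) \<noteq> 0" and "A = left_block d A * chart_mat d m C"
proof -
  have L: "left_block d A \<in> carrier_mat d d" using left_block_eq[OF A] by simp
  obtain G where G: "G \<in> carrier_mat d d" "chart_mat d m C = G * A"
    using row_span_eqD[OF A chart_mat_carrier eq] by blast
  have "1\<^sub>m d = G * left_block d A"
    using submatrix_mult_left[OF G(1) A, of "{..<d}"] left_block_chart[of d m C] G(2) by simp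
  then have "det G * det (left_block d A) = 1" using det_mult[OF G(1) L] by (metis det_one)
  then show "det (left_block d A) \<noteq> 0" by auto
  obtain H where H: "H \<in> carrier_mat d d" "A = H * chart_mat d m C"
    using row_span_eqD[OF chart_mat_carrier A eq[symmetric]] by blast
  then show "A = left_block d A * chart_mat d m C" using left_block_mult_chart[OF H(1)] by simp
qed

lemma row_span_chart_iff:
  assumes A: "A \<in> carrier_mat d (d + m)"
  shows "row_span (d + m) A \<in> range (\<lambda>C. row_span (d + m) (chart_mat d m C)) \<longleftrightarrow>
    det (left_block d A) \<noteq> 0"
proof
  assume nz: "det (left_block d A) \<noteq> 0"
  obtain C where C: "A = left_block d A * chart_mat d m C" using factor_through_chart[OF A nz] by blast
  have "left_block d A \<in> carrier_mat d d" using left_block_eq[OF A] by simp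
  from row_span_mult_left[OF this nz chart_mat_carrier[of d m C]] C
  show "row_span (d + m) A \<in> range (\<lambda>C. row_span (d + m) (chart_mat d m C))" by simp
qed (use row_span_chartD(1)[OF A] in auto)

lemma chart_mat_full_rank: "chart_mat d m C \<in> full_rank_mats d (d + m)"
  by (rule full_rank_if_minor_nonzero[OF chart_mat_carrier, of "{..<d}"]) (auto simp: left_block_chart)

text \<open>
  The dimension of the row span is the column rank of the transpose, which is \<open>d\<close> because the
  identity block is a nonzero \<open>d \<times> d\<close> minor of the transpose.
\<close>

lemma chart_row_span_in_grassmannian:
  "row_span (d + m) (chart_mat d m C) \<in> grassmannian d (d + m)"
proof -
  interpret V: vec_space "TYPE(real)" "d + m" .
  let ?A = "chart_mat d m C"
  have At: "?A\<^sup>T \<in> carrier_mat (d + m) d" by simp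
  have rows: "set (rows ?A) \<subseteq> carrier_vec (d + m)" using rows_carrier[of ?A] by (simp add: chart_mat_def)
  then have "VectorSpace.subspace class_ring (V.row_space ?A) V.V"
    unfolding V.row_space_def using V.span_is_subspace by simp
  moreover have "V.rank ?A\<^sup>T = d"
  proof (rule antisym[OF V.rank_le_nc[OF At]])
    have "submatrix ?A\<^sup>T {..<d} {..<d} = 1\<^sub>m d"
    proof -
      have "{j. j < d + m \<and> j \<in> {..<d}} = {..<d}" "{j. j < d \<and> j \<in> {..<d}} = {..<d}" by auto
      then show ?thesis
        by (intro eq_matI) (auto simp: submatrix_def chart_mat_def pick_lessThan)
    qed
    moreover have "{j. j < d \<and> j \<in> {..<d}} = {..<d}" by auto
    ultimately show "d \<le> V.rank ?A\<^sup>T" using V.rank_gt_minor[OF At, of "{..<d}" "{..<d}"] by simp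
  qed
  ultimately show ?thesis
    unfolding grassmannian_def V.rank_def V.row_space_def by simp
qed

section \<open>The hook of ones in a rational Dyck matrix\<close>

lemma horizontal_height_at_prefix:
  assumes "j < count_list p East"
  shows "\<exists>k \<le> length p. count_list (take k p) East = j \<and>
    horizontal_heights y p ! j = y + count_list (take k p) North"
  using assms
proof (induction y p arbitrary: j rule: horizontal_heights.induct)
  case (2 y p)
  show ?case
  proof (cases j)
    case 0
    then show ?thesis by (intro exI[of _ 0]) simp
  next
    case (Suc j')
    then obtain k where "k \<le> length p" "count_list (take k p) East = j'"
      "horizontal_heights y p ! j' = y + count_list (take k p) North"
      using 2(1)[of j'] 2(2) by auto
    then show ?thesis using Suc by (intro exI[of _ "Suc k"]) simp
  qed
next
  case (3 y p)
  then obtain k where "k \<le> length p" "count_list (take k p) East = j"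
      "horizontal_heights (Suc y) p ! j = Suc y + count_list (take k p) North"
    using 3(1)[of j] by auto
  then show ?case by (intro exI[of _ "Suc k"]) simp
qed simp

lemma rational_dyck_height_le:
  assumes p: "rational_dyck_path m d p" and j: "j < m"
  shows "real (horizontal_heights 0 p ! j) \<le> real d / real m * real j"
proof -
  obtain k where k: "k \<le> length p" "count_list (take k p) East = j"
      "horizontal_heights 0 p ! j = 0 + count_list (take k p) North"
    using horizontal_height_at_prefix[of j p 0] p j unfolding rational_dyck_path_def by auto
  then show ?thesis using p unfolding rational_dyck_path_def by auto
qed

text \<open>
  The first horizontal step starts on the line \<open>y = 0\<close>, so the first column has no zeros; the step
  with index \<open>j < m\<close> starts at height at most \<open>d j / m < d\<close>, so the last row has no zeros.
  The \<open>d + m - 1\<close> entries in these positions become the parameters of the cell.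
\<close>

lemma rational_dyck_matrix_hook:
  assumes A: "A \<in> rational_dyck_matrices d m" and dm: "0 < d" "0 < m"
  shows "\<And>i j. i < d \<Longrightarrow> j < m \<Longrightarrow> A $$ (i, j) \<in> {0, 1}"
    and "\<And>i. i < d \<Longrightarrow> A $$ (i, 0) = 1"
    and "\<And>j. j < m \<Longrightarrow> A $$ (d - 1, j) = 1"
proof -
  obtain p where c: "A \<in> carrier_mat d m" and e: "elements_mat A \<subseteq> {0, 1}" and p: "rational_dyck_path m d p"
    and z: "\<And>i j. i < d \<Longrightarrow> j < m \<Longrightarrow> A $$ (i, j) = 0 \<longleftrightarrow> i < horizontal_heights 0 p ! j"
    using A unfolding rational_dyck_matrices_def by blast
  show 01: "A $$ (i, j) \<in> {0, 1}" if "i < d" "j < m" for i j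
    using e c that elements_matI[OF c that refl] by auto
  show "A $$ (i, 0) = 1" if "i < d" for i
    using rational_dyck_height_le[OF p dm(2)] z[OF that dm(2)] 01[OF that dm(2)] by simp
  show "A $$ (d - 1, j) = 1" if j: "j < m" for j
  proof -
    have "real d / real m * real j < real d" using j dm by (simp add: field_simps)
    then have "horizontal_heights 0 p ! j < d" using rational_dyck_height_le[OF p j] by linarith
    then show ?thesis using z[of "d - 1" j] 01[of "d - 1" j] j dm by auto
  qed
qed

definition phi_block :: "nat \<Rightarrow> real mat \<Rightarrow> nat \<Rightarrow> nat \<Rightarrow> real" where
  "phi_block d A i j = (- 1) ^ (d - 1 - i) * A $$ (d - 1 - i, j)"

lemma phi_eq_chart_mat: "phi d m A = chart_mat d m (phi_block d A)"
  by (rule eq_matI) (auto simp: phi_def chart_mat_def phi_block_def)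

section \<open>Minors that exchange one or two columns of the identity block\<close>

text \<open>
  Column \<open>i\<close> of the identity block is replaced by column \<open>j\<close> of \<open>C\<close>, which comes last in the
  increasing order of columns.  Row \<open>i\<close> of the resulting matrix can be nonzero only in the
  last position, and deleting that row and column leaves an identity matrix.
\<close>

lemma minor_exchange:
  assumes i: "i < d" and j: "j < m"
  shows "det (submatrix (chart_mat d m C) {..<d} (insert (d + j) ({..<d} - {i}))) =
    (- 1) ^ (d - 1 - i) * C i j"
proof -
  let ?B = "insert (d + j) ({..<d} - {i})"
  have B: "?B \<subseteq> {..<d + m}" "card ?B = d" using i j by auto
  have pk: "pick ?B k = (if k < i then k else if k < d - 1 then Suc k else d + j)"
    if kd: "k < d" for k
  proof -
    consider "k < i" | "i \<le> k" "k < d - 1" | "k = d - 1" using kd by linarith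
    then show ?thesis
    proof cases
      case 1
      have "{a \<in> ?B. a < k} = {..<k}" using 1 i by auto
      then show ?thesis using pick_card_in_set[of k ?B] 1 i by simp
    next
      case 2
      have "{a \<in> ?B. a < Suc k} = {..<Suc k} - {i}" using 2 by auto
      moreover have "card ({..<Suc k} - {i}) = k" using 2 by simp
      ultimately show ?thesis using pick_card_in_set[of "Suc k" ?B] 2 less_diff_conv[of k d 1] by auto
    next
      case 3
      have "{a \<in> ?B. a < d + j} = {..<d} - {i}" by auto
      moreover have "card ({..<d} - {i}) = d - 1" using i by simp
      ultimately show ?thesis using pick_card_in_set[of "d + j" ?B] 3 i by simp
    qed
  qed
  define S where "S = mat d d (\<lambda>(a, k). chart_mat d m C $$ (a, pick ?B k))"
  have S: "S \<in> carrier_mat d d" by (simp add: S_def)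
  have Sak: "S $$ (a, k) = (if k < d - 1 then (if a = (if k < i then k else Suc k) then 1 else 0) else C a j)"
    if "a < d" "k < d" for a k
    using that i j pk[OF that(2)] by (auto simp: S_def chart_mat_def)
  have "mat_delete S i (d - 1) = 1\<^sub>m (d - 1)"
    using i S by (intro eq_matI) (auto simp: mat_delete_def Sak)
  then have cof: "cofactor S i (d - 1) = (- 1) ^ (i + (d - 1))" by (simp add: cofactor_def)
  have "det S = (\<Sum>k<d. S $$ (i, k) * cofactor S i k)" by (rule laplace_expansion_row[OF S i])
  also have "\<dots> = (\<Sum>k\<in>{d - 1}. S $$ (i, k) * cofactor S i k)"
    using i by (intro sum.mono_neutral_right) (auto simp: Sak)
  also have "\<dots> = S $$ (i, d - 1) * cofactor S i (d - 1)" by simp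
  also have "\<dots> = (- 1) ^ (i + (d - 1)) * C i j" unfolding cof using i by (simp add: Sak)
  also have "(- 1 :: real) ^ (i + (d - 1)) = (- 1) ^ (d - 1 - i)"
  proof -
    have "i + (d - 1) = 2 * i + (d - 1 - i)" using i by simp
    then show ?thesis by (simp only: power_add power_minus1_even mult_1)
  qed
  finally show ?thesis unfolding S_def submatrix_all_rows[OF chart_mat_carrier B] .
qed

text \<open>
  A row vector orthogonal to the remaining unit columns is supported on \<open>{i, i'}\<close>, so it
  annihilates all selected columns iff it annihilates the \<open>2 \<times> 2\<close> submatrix of \<open>C\<close> in rows \<open>i, i'\<close>
  and columns \<open>j, j'\<close>.
\<close>

lemma double_exchange_minor_zero_iff:
  assumes i: "i < d" "i' < d" "i \<noteq> i'" and j: "j < m" "j' < m" "j \<noteq> j'"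
  shows "det (submatrix (chart_mat d m C) {..<d} ({d + j, d + j'} \<union> ({..<d} - {i, i'}))) = 0 \<longleftrightarrow>
    C i j * C i' j' = C i j' * C i' j"
proof -
  let ?B = "{d + j, d + j'} \<union> ({..<d} - {i, i'})"
  have "card ?B = card {d + j, d + j'} + card ({..<d} - {i, i'})"
    by (intro card_Un_disjoint) auto
  also have "\<dots> = 2 + (d - 2)" using i j by (simp add: card_Diff_subset)
  finally have B: "?B \<subseteq> {..<d + m}" "card ?B = d" using i j by auto
  have left: "(\<Sum>a<d. v a * chart_mat d m C $$ (a, b)) = v b" if "b < d" for v b
  proof -
    have "(\<Sum>a<d. v a * chart_mat d m C $$ (a, b)) = (\<Sum>a<d. if a = b then v a else 0)"
      using that by (intro sum.cong) (auto simp: chart_mat_def)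
    then show ?thesis using that by simp
  qed
  have right: "(\<Sum>a<d. v a * chart_mat d m C $$ (a, d + k)) = v i * C i k + v i' * C i' k"
    if "k < m" "\<forall>b \<in> {..<d} - {i, i'}. v b = 0" for v k
  proof -
    have "(\<Sum>a<d. v a * chart_mat d m C $$ (a, d + k)) = (\<Sum>a\<in>{i, i'}. v a * C a k)"
      using that i by (intro sum.mono_neutral_cong_right) (auto simp: chart_mat_def)
    then show ?thesis using i by simp
  qed
  have "(\<forall>b\<in>?B. (\<Sum>a<d. v a * chart_mat d m C $$ (a, b)) = 0) \<longleftrightarrow>
    (\<forall>b \<in> {..<d} - {i, i'}. v b = 0) \<and>
    v i * C i j + v i' * C i' j = 0 \<and> v i * C i j' + v i' * C i' j' = 0" for v
  proof -
    have "(\<forall>b\<in>?B. (\<Sum>a<d. v a * chart_mat d m C $$ (a, b)) = 0) \<longleftrightarrow>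
      (\<forall>b \<in> {..<d} - {i, i'}. v b = 0) \<and> (\<Sum>a<d. v a * chart_mat d m C $$ (a, d + j)) = 0 \<and>
      (\<Sum>a<d. v a * chart_mat d m C $$ (a, d + j')) = 0"
      using left[of _ v] by auto
    then show ?thesis using right[OF j(1), of v] right[OF j(2), of v]
      by (cases "\<forall>b \<in> {..<d} - {i, i'}. v b = 0") auto
  qed
  then have "det (submatrix (chart_mat d m C) {..<d} ?B) = 0 \<longleftrightarrow>
    (\<exists>v. (\<exists>a<d. v a \<noteq> 0) \<and> (\<forall>b \<in> {..<d} - {i, i'}. v b = 0) \<and>
      v i * C i j + v i' * C i' j = 0 \<and> v i * C i j' + v i' * C i' j' = 0)" (is "_ \<longleftrightarrow> (\<exists>v. ?K v)")
    using minor_zero_iff_annihilated[OF chart_mat_carrier B, of C] by simp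
  also have "\<dots> \<longleftrightarrow> C i j * C i' j' = C i j' * C i' j"
  proof
    assume "\<exists>v. ?K v"
    then obtain v where v: "?K v" by blast
    then have nz: "v i \<noteq> 0 \<or> v i' \<noteq> 0" by (metis Diff_iff empty_iff insert_iff lessThan_iff)
    have e: "v i * C i j + v i' * C i' j = 0" "v i * C i j' + v i' * C i' j' = 0" using v by auto
    have "v i * (C i j * C i' j' - C i j' * C i' j) =
      (v i * C i j + v i' * C i' j) * C i' j' - (v i * C i j' + v i' * C i' j') * C i' j"
      by (simp add: algebra_simps)
    moreover have "v i' * (C i j * C i' j' - C i j' * C i' j) =
      (v i * C i j' + v i' * C i' j') * C i j - (v i * C i j + v i' * C i' j) * C i j'"
      by (simp add: algebra_simps)
    ultimately show "C i j * C i' j' = C i j' * C i' j" unfolding e using nz by auto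
  next
    assume eq: "C i j * C i' j' = C i j' * C i' j"
    \<comment> \<open>The annihilating vector is read off from a nonzero column; if both columns vanish, any
      nonzero vector supported on \<open>{i, i'}\<close> will do.\<close>
    define w where "w = (\<lambda>x y. (\<lambda>_. 0 :: real)(i := x, i' := y))"
    have w: "?K (w x y) \<longleftrightarrow> (x \<noteq> 0 \<or> y \<noteq> 0) \<and>
      x * C i j + y * C i' j = 0 \<and> x * C i j' + y * C i' j' = 0" for x y
      using i by (auto simp: w_def)
    consider "C i' j \<noteq> 0 \<or> C i j \<noteq> 0" | "C i' j = 0" "C i j = 0" "C i' j' \<noteq> 0 \<or> C i j' \<noteq> 0"
      | "C i' j = 0" "C i j = 0" "C i' j' = 0" "C i j' = 0" by blast
    then show "\<exists>v. ?K v"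
    proof cases
      case 1
      then have "?K (w (C i' j) (- C i j))" unfolding w using eq by (auto simp: algebra_simps)
      then show ?thesis by blast
    next
      case 2
      then have "?K (w (C i' j') (- C i j'))" unfolding w by (auto simp: algebra_simps)
      then show ?thesis by blast
    next
      case 3
      then have "?K (w 1 0)" unfolding w by auto
      then show ?thesis by blast
    qed
  qed
  finally show ?thesis .
qed

section \<open>Positroid cells of hook patterns\<close>

lemma nonneg_matsI:
  assumes "A \<in> full_rank_mats d n"
    and "\<And>B. B \<subseteq> {..<n} \<Longrightarrow> card B = d \<Longrightarrow> 0 \<le> det (submatrix A {..<d} B)"
  shows "A \<in> nonneg_mats d n"
  using assms by (simp add: nonneg_mats_def)

lemma nonneg_matsD:
  assumes "A \<in> nonneg_mats d n" "B \<subseteq> {..<n}" "card B = d"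
  shows "0 \<le> det (submatrix A {..<d} B)"
  using assms by (simp add: nonneg_mats_def)

lemma represented_matroid_eq_iff:
  assumes A: "A \<in> carrier_mat d n" and B: "B \<in> carrier_mat d n"
  shows "represented_matroid A = represented_matroid B \<longleftrightarrow>
    (\<forall>S \<subseteq> {..<n}. card S = d \<longrightarrow>
      (det (submatrix A {..<d} S) = 0 \<longleftrightarrow> det (submatrix B {..<d} S) = 0))"
  unfolding represented_matroid_eq_minors[OF A] represented_matroid_eq_minors[OF B]
  by (auto simp: set_eq_iff)

lemma det_submatrix_mult_left:
  fixes G :: "real mat"
  assumes G: "G \<in> carrier_mat d d" and A: "A \<in> carrier_mat d n" and B: "B \<subseteq> {..<n}" "card B = d"
  shows "det (submatrix (G * A) {..<d} B) = det G * det (submatrix A {..<d} B)"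
  using det_mult[OF G, of "submatrix A {..<d} B"] submatrix_all_rows[OF A B]
  by (simp add: submatrix_mult_left[OF G A B])

lemma represented_matroid_mult_left:
  fixes G :: "real mat"
  assumes G: "G \<in> carrier_mat d d" "det G \<noteq> 0" and A: "A \<in> carrier_mat d n"
  shows "represented_matroid (G * A) = represented_matroid A"
proof -
  have "G * A \<in> carrier_mat d n" using G A by simp
  then show ?thesis unfolding represented_matroid_eq_iff[OF \<open>G * A \<in> carrier_mat d n\<close> A]
    using det_submatrix_mult_left[OF G(1) A] G(2) by simp
qed

lemma factor_through_chart_if_matroid:
  assumes A: "A \<in> carrier_mat d (d + m)"
    and M: "represented_matroid A = represented_matroid (chart_mat d m C0)"
  shows "\<exists>C. det (left_block d A) \<noteq> 0 \<and> A = left_block d A * chart_mat d m C"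
proof -
  have "det (left_block d A) = 0 \<longleftrightarrow> det (left_block d (chart_mat d m C0)) = 0"
    using M unfolding represented_matroid_eq_iff[OF A chart_mat_carrier] by auto
  then have "det (left_block d A) \<noteq> 0" by (simp add: left_block_chart)
  then show ?thesis using factor_through_chart[OF A] by blast
qed

text \<open>
  The first \<open>d\<close> columns of \<open>G (I | C)\<close> have minor \<open>det G\<close>.  Nonnegativity of the minors therefore
  forces \<open>det G > 0\<close>, and the minors of \<open>(I | C)\<close> inherit their signs.
\<close>

lemma chart_nonneg:
  assumes G: "G \<in> carrier_mat d d" and N: "G * chart_mat d m C \<in> nonneg_mats d (d + m)"
    and nz: "det G \<noteq> 0"
  shows "chart_mat d m C \<in> nonneg_mats d (d + m)"
proof (rule nonneg_matsI[OF chart_mat_full_rank])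
  have ge: "0 \<le> det G * det (submatrix (chart_mat d m C) {..<d} B)"
    if "B \<subseteq> {..<d + m}" "card B = d" for B
    using nonneg_matsD[OF N that] unfolding det_submatrix_mult_left[OF G chart_mat_carrier that] .
  have "0 < det G" using ge[of "{..<d}"] nz by (auto simp: left_block_chart)
  then show "0 \<le> det (submatrix (chart_mat d m C) {..<d} B)" if "B \<subseteq> {..<d + m}" "card B = d" for B
    using ge[OF that] by (simp add: zero_le_mult_iff)
qed

text \<open>
  The factor \<open>r i\<close> of a row also rescales the identity block; this is undone by the factor
  \<open>1 / r i\<close> on column \<open>i\<close>.
\<close>

lemma chart_rescale:
  assumes r: "\<And>i. 0 < r i" and c: "\<And>j. 0 < c j"
    and C: "\<And>i j. i < d \<Longrightarrow> j < m \<Longrightarrow> C i j = r i * c j * C0 i j"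
  shows "represented_matroid (chart_mat d m C) = represented_matroid (chart_mat d m C0)"
    and "chart_mat d m C \<in> nonneg_mats d (d + m) \<longleftrightarrow> chart_mat d m C0 \<in> nonneg_mats d (d + m)"
proof -
  define s where "s = (\<lambda>j. if j < d then inverse (r j) else c (j - d))"
  have s: "0 < s j" for j using r c by (simp add: s_def)
  have sc: "chart_mat d m C $$ (i, j) = r i * s j * chart_mat d m C0 $$ (i, j)"
    if "i < d" "j < d + m" for i j
    using that C[of i "j - d"] r[of i] by (auto simp: chart_mat_def s_def)
  have minor: "det (submatrix (chart_mat d m C) {..<d} B) =
      (\<Prod>i<d. r i) * (\<Prod>b\<in>B. s b) * det (submatrix (chart_mat d m C0) {..<d} B)"
    if "B \<subseteq> {..<d + m}" "card B = d" for B
    by (rule minor_rescale[OF chart_mat_carrier chart_mat_carrier that sc])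
  have pos: "0 < (\<Prod>i<d. r i) * (\<Prod>b\<in>B. s b)" for B using r s by (simp add: prod_pos)
  have zero_iff: "k * x = 0 \<longleftrightarrow> x = 0" and nonneg_iff: "0 \<le> k * x \<longleftrightarrow> 0 \<le> x"
    if "0 < k" for k x :: real
    using that by (simp_all add: zero_le_mult_iff)
  show "represented_matroid (chart_mat d m C) = represented_matroid (chart_mat d m C0)"
    unfolding represented_matroid_eq_iff[OF chart_mat_carrier chart_mat_carrier]
    using minor zero_iff[OF pos] by simp
  have "0 \<le> det (submatrix (chart_mat d m C) {..<d} B) \<longleftrightarrow>
      0 \<le> det (submatrix (chart_mat d m C0) {..<d} B)"
    if "B \<subseteq> {..<d + m}" "card B = d" for B
    unfolding minor[OF that] by (rule nonneg_iff[OF pos])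
  then show "chart_mat d m C \<in> nonneg_mats d (d + m) \<longleftrightarrow> chart_mat d m C0 \<in> nonneg_mats d (d + m)"
    unfolding nonneg_mats_def using chart_mat_full_rank by simp
qed

text \<open>
  What is needed of the right block of \<^term>\<open>phi d m A\<close> for a rational Dyck matrix \<open>A\<close>: up to the
  row signs its entries are \<open>0\<close> or \<open>1\<close>, and its first row and first column have no zeros.  Since
  \<^const>\<open>phi\<close> reverses the rows, the first row here is the last row of \<open>A\<close>.
\<close>

locale hook_pattern =
  fixes d m :: nat and C0 :: "nat \<Rightarrow> nat \<Rightarrow> real"
  assumes d: "0 < d" and m: "0 < m"
    and entry: "\<And>i j. i < d \<Longrightarrow> j < m \<Longrightarrow> C0 i j \<in> {0, (- 1) ^ (d - 1 - i)}"
    and first_col: "\<And>i. i < d \<Longrightarrow> C0 i 0 \<noteq> 0"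
    and first_row: "\<And>j. j < m \<Longrightarrow> C0 0 j \<noteq> 0"
begin

text \<open>
  The single exchanges show that \<open>C\<close> has the zeros of \<open>C0\<close> and the signs \<open>(-1)\<^bsup>d-1-i\<^esup>\<close>.  If
  \<open>C0 i j \<noteq> 0\<close>, then the \<open>2 \<times> 2\<close> minor of \<open>C0\<close> in rows \<open>0, i\<close> and columns \<open>0, j\<close> vanishes because
  all four entries are row signs.  The matroid transports this to \<open>C\<close>, which is therefore determined
  by its first row and first column:
  \<open>\<bar>C i j\<bar> = \<bar>C i 0\<bar> \<bar>C 0 j\<bar> / \<bar>C 0 0\<bar>\<close>.
\<close>

lemma rank_one_on_pattern:
  assumes N: "chart_mat d m C \<in> nonneg_mats d (d + m)"
    and M: "represented_matroid (chart_mat d m C) = represented_matroid (chart_mat d m C0)"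
  shows "\<exists>r c. (\<forall>i. 0 < r i) \<and> (\<forall>j. 0 < c j) \<and>
    (\<forall>i<d. \<forall>j<m. C i j = r i * c j * C0 i j)"
proof -
  let ?s = "\<lambda>i. (- 1 :: real) ^ (d - 1 - i)"
  have ss: "?s i * ?s i = 1" for i by (simp flip: power_add power_mult_distrib)
  have minors: "det (submatrix (chart_mat d m C) {..<d} B) = 0 \<longleftrightarrow>
      det (submatrix (chart_mat d m C0) {..<d} B) = 0" if "B \<subseteq> {..<d + m}" "card B = d" for B
    using M that unfolding represented_matroid_eq_iff[OF chart_mat_carrier chart_mat_carrier] by blast
  have ex: "insert (d + j) ({..<d} - {i}) \<subseteq> {..<d + m}" "card (insert (d + j) ({..<d} - {i})) = d"
    if "i < d" "j < m" for i j using that by auto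
  have zero: "C i j = 0 \<longleftrightarrow> C0 i j = 0" if "i < d" "j < m" for i j
    using minors[OF ex[OF that]] by (simp add: minor_exchange that)
  have nonneg: "0 \<le> ?s i * C i j" if "i < d" "j < m" for i j
    using nonneg_matsD[OF N ex[OF that]] unfolding minor_exchange[OF that] .
  have abs: "C i j = ?s i * \<bar>C i j\<bar>" if "i < d" "j < m" for i j
  proof -
    have "\<bar>C i j\<bar> = \<bar>?s i * C i j\<bar>" by (simp add: abs_mult)
    also have "\<dots> = ?s i * C i j" using nonneg[OF that] by simp
    finally show ?thesis using ss[of i] by (simp add: mult.assoc[symmetric])
  qed
  have prod: "C 0 0 * C i j = C 0 j * C i 0" if ij: "i < d" "j < m" and nz: "C0 i j \<noteq> 0" for i j
  proof (cases "i = 0 \<or> j = 0")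
    case True
    then show ?thesis by (auto simp: mult.commute)
  next
    case False
    have "C0 0 0 * C0 i j = C0 0 j * C0 i 0"
      using entry[OF d m] entry[OF ij] entry[OF d ij(2)] entry[OF ij(1) m]
        first_row[OF m] first_row[OF ij(2)] first_col[OF ij(1)] nz by simp
    then have "det (submatrix (chart_mat d m C0) {..<d} ({d + 0, d + j} \<union> ({..<d} - {0, i}))) = 0"
      using double_exchange_minor_zero_iff[of 0 d i 0 m j C0] False ij d m by simp
    moreover have "card ({d + 0, d + j} \<union> ({..<d} - {0, i})) = d"
    proof -
      have "card ({d + 0, d + j} \<union> ({..<d} - {0, i})) = card {d + 0, d + j} + card ({..<d} - {0, i})"
        by (intro card_Un_disjoint) auto
      then show ?thesis using False ij d by (simp add: card_Diff_subset, arith)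
    qed
    ultimately have "det (submatrix (chart_mat d m C) {..<d} ({d + 0, d + j} \<union> ({..<d} - {0, i}))) = 0"
      using minors[of "{d + 0, d + j} \<union> ({..<d} - {0, i})"] ij m by (fastforce simp: subset_iff)
    then show ?thesis
      using double_exchange_minor_zero_iff[of 0 d i 0 m j C] False ij d m by simp
  qed
  \<comment> \<open>The value 1 outside the index range keeps the factors positive everywhere.\<close>
  define r where "r = (\<lambda>i. if i < d then \<bar>C i 0\<bar> else 1)"
  define c where "c = (\<lambda>j. if j < m then \<bar>C 0 j\<bar> / \<bar>C 0 0\<bar> else 1)"
  have C00: "C 0 0 \<noteq> 0" using zero[OF d m] first_row[OF m] by simp
  have "0 < r i" for i using zero[OF _ m, of i] first_col[of i] by (auto simp: r_def)
  moreover have "0 < c j" for j using zero[OF d] first_row C00 by (auto simp: c_def)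
  moreover have "C i j = r i * c j * C0 i j" if ij: "i < d" "j < m" for i j
  proof (cases "C0 i j = 0")
    case True
    then show ?thesis using zero[OF ij] by simp
  next
    case False
    then have "\<bar>C 0 0\<bar> * \<bar>C i j\<bar> = \<bar>C 0 j\<bar> * \<bar>C i 0\<bar>" using prod[OF ij] by (simp flip: abs_mult)
    then have "\<bar>C i j\<bar> = r i * c j" using C00 ij by (simp add: r_def c_def field_simps)
    then show ?thesis using abs[OF ij] entry[OF ij] False by simp
  qed
  ultimately show ?thesis by (intro exI[of _ r] exI[of _ c] conjI allI impI)
qed

text \<open>
  One inclusion normalizes a point of the cell to \<open>(I | C)\<close> and applies
  \<open>rank_one_on_pattern\<close>.  For the other, the minors of \<open>(I | C0)\<close> must be shown to be nonnegative.
  Since \<open>P\<close> is a positroid, some nonnegative matrix represents it; its normal form is a positive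
  rescaling of \<open>(I | C0)\<close>, so \<open>(I | C0)\<close> and all its positive rescalings are nonnegative as
  well.
\<close>

lemma positroid_cell_eq:
  assumes P: "P = represented_matroid (chart_mat d m C0)" and pos: "positroid d (d + m) P"
  shows "positroid_cell d (d + m) P =
    {row_span (d + m) (chart_mat d m (\<lambda>i j. r i * c j * C0 i j)) | r c.
       (\<forall>i. 0 < r i) \<and> (\<forall>j. 0 < c j)}"  (is "_ = ?T")
proof (intro equalityI subsetI)
  fix V assume "V \<in> positroid_cell d (d + m) P"
  then obtain A A2 where A: "A \<in> full_rank_mats d (d + m)" "V = row_span (d + m) A"
      "represented_matroid A = P"
    and A2: "A2 \<in> nonneg_mats d (d + m)" "V = row_span (d + m) A2"
    unfolding positroid_cell_def matroid_stratum_def nonneg_grassmannian_def by blast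
  have carr: "A \<in> carrier_mat d (d + m)" "A2 \<in> carrier_mat d (d + m)"
    using A(1) A2(1) by (auto simp: full_rank_mats_def nonneg_mats_def)
  obtain C where C: "det (left_block d A) \<noteq> 0" "A = left_block d A * chart_mat d m C"
    using factor_through_chart_if_matroid[OF carr(1)] A(3) P by blast
  have L: "left_block d A \<in> carrier_mat d d" "left_block d A2 \<in> carrier_mat d d"
    using left_block_eq carr by auto
  have V: "V = row_span (d + m) (chart_mat d m C)"
    using row_span_mult_left[OF L(1) C(1) chart_mat_carrier[of d m C]] C(2) A(2) by simp
  have M: "represented_matroid (chart_mat d m C) = represented_matroid (chart_mat d m C0)"
    using represented_matroid_mult_left[OF L(1) C(1) chart_mat_carrier[of d m C]] C(2) A(3) P by simp
  have "chart_mat d m C \<in> nonneg_mats d (d + m)"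
    using chart_nonneg[OF L(2), of m C] row_span_chartD[OF carr(2), of C] A2 V by simp
  from rank_one_on_pattern[OF this M] obtain r c where rc: "\<forall>i. 0 < r i" "\<forall>j. 0 < c j"
    and eq: "\<forall>i<d. \<forall>j<m. C i j = r i * c j * C0 i j" by blast
  have "chart_mat d m C = chart_mat d m (\<lambda>i j. r i * c j * C0 i j)"
    using eq by (intro eq_matI) (auto simp: chart_mat_def)
  then have "V = row_span (d + m) (chart_mat d m (\<lambda>i j. r i * c j * C0 i j))" using V by simp
  then show "V \<in> ?T" using rc by blast
next
  fix V assume "V \<in> ?T"
  then obtain r c where rc: "\<And>i. 0 < r i" "\<And>j. 0 < c j"
    and V: "V = row_span (d + m) (chart_mat d m (\<lambda>i j. r i * c j * C0 i j))" by blast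
  obtain A where A: "A \<in> nonneg_mats d (d + m)" "represented_matroid A = P"
    using pos unfolding positroid_def by blast
  have carr: "A \<in> carrier_mat d (d + m)" using A(1) by (auto simp: full_rank_mats_def nonneg_mats_def)
  have L: "left_block d A \<in> carrier_mat d d" using left_block_eq carr by auto
  obtain C where C: "det (left_block d A) \<noteq> 0" "A = left_block d A * chart_mat d m C"
    using factor_through_chart_if_matroid[OF carr] A(2) P by blast
  have M: "represented_matroid (chart_mat d m C) = represented_matroid (chart_mat d m C0)"
    using represented_matroid_mult_left[OF L C(1) chart_mat_carrier[of d m C]] C(2) A(2) P by simp
  have N: "chart_mat d m C \<in> nonneg_mats d (d + m)"
    using chart_nonneg[OF L, of m C] C A(1) by simp
  from rank_one_on_pattern[OF N M] obtain r' c' where rc': "\<forall>i. 0 < r' i" "\<forall>j. 0 < c' j"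
    and eq: "\<forall>i<d. \<forall>j<m. C i j = r' i * c' j * C0 i j" by blast
  have "chart_mat d m C0 \<in> nonneg_mats d (d + m)"
    using chart_rescale(2)[of r' c' d m C C0] rc' eq N by blast
  then have N': "chart_mat d m (\<lambda>i j. r i * c j * C0 i j) \<in> nonneg_mats d (d + m)"
    using chart_rescale(2)[of r c d m "\<lambda>i j. r i * c j * C0 i j" C0] rc by blast
  have M': "represented_matroid (chart_mat d m (\<lambda>i j. r i * c j * C0 i j)) = P"
    using chart_rescale(1)[of r c d m "\<lambda>i j. r i * c j * C0 i j" C0] rc P by blast
  show "V \<in> positroid_cell d (d + m) P"
    unfolding positroid_cell_def matroid_stratum_def nonneg_grassmannian_def V
    using N' M' chart_mat_full_rank chart_row_span_in_grassmannian by blast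
qed

end

lemma hook_pattern_phi_block:
  assumes A: "A \<in> rational_dyck_matrices d m" and dm: "0 < d" "0 < m"
  shows "hook_pattern d m (phi_block d A)"
proof
  note hook = rational_dyck_matrix_hook[OF assms]
  show "phi_block d A i j \<in> {0, (- 1) ^ (d - 1 - i)}" if "i < d" "j < m" for i j
    using hook(1)[of "d - 1 - i" j] that by (auto simp: phi_block_def)
  show "phi_block d A i 0 \<noteq> 0" if "i < d" for i
    using hook(2)[of "d - 1 - i"] that by (simp add: phi_block_def)
  show "phi_block d A 0 j \<noteq> 0" if "j < m" for j
    using hook(3)[OF that] by (simp add: phi_block_def)
qed (use dm in auto)

section \<open>Continuity of the chart\<close>

lemma continuous_map_mat_entry:
  assumes "i < d" "j < n"
  shows "continuous_map (mat_topology d n) euclideanreal (\<lambda>A. A $$ (i, j))"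
proof -
  let ?I = "{..<d} \<times> {..<n}"
  have "continuous_map (product_topology (\<lambda>_. euclideanreal) ?I) euclideanreal (\<lambda>x. x (i, j))"
    by (rule continuous_map_product_projection) (use assms in auto)
  from continuous_map_pullback[OF this, of "carrier_mat d n" "\<lambda>A. \<lambda>ij \<in> ?I. A $$ ij"]
  show ?thesis using assms unfolding mat_topology_def by (simp add: comp_def)
qed

lemma continuous_map_into_mat_topology:
  assumes "\<And>x. x \<in> topspace X \<Longrightarrow> f x \<in> carrier_mat d n"
    and "\<And>i j. i < d \<Longrightarrow> j < n \<Longrightarrow> continuous_map X euclideanreal (\<lambda>x. f x $$ (i, j))"
  shows "continuous_map X (mat_topology d n) f"
  unfolding mat_topology_def
proof (rule continuous_map_pullback')
  show "continuous_map X (product_topology (\<lambda>_. euclideanreal) ({..<d} \<times> {..<n}))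
     ((\<lambda>A. \<lambda>ij\<in>{..<d} \<times> {..<n}. A $$ ij) \<circ> f)"
    unfolding continuous_map_componentwise using assms(2) by (auto simp: comp_def)
qed (use assms(1) in auto)

lemma continuous_map_det:
  fixes f :: "'a \<Rightarrow> real mat"
  assumes "\<And>x. f x \<in> carrier_mat k k"
    and "\<And>i j. i < k \<Longrightarrow> j < k \<Longrightarrow> continuous_map X euclideanreal (\<lambda>x. f x $$ (i, j))"
  shows "continuous_map X euclideanreal (\<lambda>x. det (f x))"
proof -
  have "det (f x) = (\<Sum>p | p permutes {0..<k}. signof p * (\<Prod>i = 0..<k. f x $$ (i, p i)))" for x
    using assms(1)[of x] by (simp add: det_def)
  moreover have "continuous_map X euclideanreal
      (\<lambda>x. \<Sum>p | p permutes {0..<k}. signof p * (\<Prod>i = 0..<k. f x $$ (i, p i)))"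
  proof (intro continuous_map_sum continuous_map_real_mult continuous_map_prod)
    fix p i assume "p \<in> {p. p permutes {0..<k}}" "i \<in> {0..<k}"
    then have "i < k" "p i < k" using permutes_in_image[of p "{0..<k}" i] by auto
    then show "continuous_map X euclideanreal (\<lambda>x. f x $$ (i, p i))" by (rule assms(2))
  qed (auto simp: finite_permutations)
  ultimately show ?thesis by presburger
qed

lemma continuous_map_left_block_det:
  "continuous_map (mat_topology d (d + m)) euclideanreal (\<lambda>A. det (left_block d A))"
proof -
  have "continuous_map (mat_topology d (d + m)) euclideanreal (\<lambda>A. det (mat d d (\<lambda>ij. A $$ ij)))"
    by (intro continuous_map_det) (auto intro!: continuous_map_mat_entry)
  then show ?thesis
    by (rule continuous_map_eq) (simp add: topspace_mat_topology left_block_eq)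
qed

lemma continuous_map_chart_coord:
  assumes ij: "i < d" "j < m"
  shows "continuous_map
    (subtopology (mat_topology d (d + m)) {A. det (left_block d A) \<noteq> 0}) euclideanreal (chart_coord d i j)"
proof -
  let ?N = "\<lambda>A. mat d d (\<lambda>(a, k). if k = i then A $$ (a, d + j) else A $$ (a, k))"
  have "continuous_map (mat_topology d (d + m)) euclideanreal (\<lambda>A. det (?N A))"
  proof (intro continuous_map_det)
    fix a k assume "a < d" "k < d"
    then show "continuous_map (mat_topology d (d + m)) euclideanreal (\<lambda>A. ?N A $$ (a, k))"
      using ij by (cases "k = i") (auto intro!: continuous_map_mat_entry)
  qed auto
  moreover have "?N A = replace_col (left_block d A) (col A (d + j)) i" if "A \<in> carrier_mat d (d + m)" for A
    using that ij by (intro eq_matI) (auto simp: replace_col_def left_block_eq)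
  ultimately have "continuous_map (mat_topology d (d + m)) euclideanreal
      (\<lambda>A. det (replace_col (left_block d A) (col A (d + j)) i))"
    by (elim continuous_map_eq) (simp add: topspace_mat_topology)
  then show ?thesis unfolding chart_coord_def
    by (intro continuous_map_real_divide continuous_map_from_subtopology continuous_map_left_block_det) auto
qed

definition chart_domain :: "nat \<Rightarrow> nat \<Rightarrow> real vec set set" where
  "chart_domain d m = range (\<lambda>C. row_span (d + m) (chart_mat d m C))"

text \<open>
  The chart coordinate of an arbitrarily chosen matrix with row span \<open>V\<close>; on \<open>chart_domain\<close> every
  choice gives the same value.
\<close>

definition plane_coord :: "nat \<Rightarrow> nat \<Rightarrow> nat \<Rightarrow> nat \<Rightarrow> real vec set \<Rightarrow> real" where
  "plane_coord d m i j V = chart_coord d i j (SOME A. A \<in> carrier_mat d (d + m) \<and> row_span (d + m) A = V)"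

lemma plane_coord_row_span:
  assumes A: "A \<in> carrier_mat d (d + m)" and V: "row_span (d + m) A \<in> chart_domain d m"
    and ij: "i < d" "j < m"
  shows "plane_coord d m i j (row_span (d + m) A) = chart_coord d i j A"
proof -
  obtain C where C: "row_span (d + m) A = row_span (d + m) (chart_mat d m C)"
    using V by (auto simp: chart_domain_def)
  have *: "chart_coord d i j B = C i j"
    if B: "B \<in> carrier_mat d (d + m)" "row_span (d + m) B = row_span (d + m) A" for B
  proof -
    have L: "left_block d B \<in> carrier_mat d d" using left_block_eq[OF B(1)] by simp
    show ?thesis
      using chart_coord_mult_chart[OF L _ ij, of C] row_span_chartD[OF B(1), of C] B(2) C by simp
  qed
  let ?B = "SOME B. B \<in> carrier_mat d (d + m) \<and> row_span (d + m) B = row_span (d + m) A"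
  have "?B \<in> carrier_mat d (d + m) \<and> row_span (d + m) ?B = row_span (d + m) A"
    by (rule someI[of _ A]) (use A in simp)
  then show ?thesis unfolding plane_coord_def using *[of ?B] *[OF A refl] by simp
qed

lemma plane_coord_chart:
  assumes "i < d" "j < m"
  shows "plane_coord d m i j (row_span (d + m) (chart_mat d m C)) = C i j"
  using plane_coord_row_span[OF chart_mat_carrier _ assms, of C]
    chart_coord_mult_chart[of "1\<^sub>m d" d i j m C] assms
  by (simp add: chart_domain_def left_mult_one_mat[OF chart_mat_carrier])

text \<open>
  In the quotient topology, openness is tested on matrices.  There the chart domain is the open
  condition \<open>det L \<noteq> 0\<close> on the left block, and on it the coordinate is the continuous function
  \<^const>\<open>chart_coord\<close>.
\<close>

lemma openin_plane_coord_preimage: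
  assumes ij: "i < d" "j < m" and W: "open W"
  shows "openin (grassmannian_topology d (d + m)) {V \<in> chart_domain d m. plane_coord d m i j V \<in> W}"
  unfolding openin_grassmannian_topology
proof
  show "{V \<in> chart_domain d m. plane_coord d m i j V \<in> W} \<subseteq> grassmannian d (d + m)"
    using chart_row_span_in_grassmannian by (auto simp: chart_domain_def)
  let ?X = "mat_topology d (d + m)" and ?F = "full_rank_mats d (d + m)"
  let ?D = "{A. det (left_block d A) \<noteq> 0}"
  have "openin ?X {A \<in> topspace ?X. det (left_block d A) \<in> - {0}}"
    by (rule openin_continuous_map_preimage[OF continuous_map_left_block_det]) auto
  moreover have "{A \<in> topspace ?X. det (left_block d A) \<in> - {0}} = topspace ?X \<inter> ?D" by auto
  ultimately have D: "openin ?X (topspace ?X \<inter> ?D)" by simp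
  have "openin (subtopology ?X ?D) {A \<in> topspace (subtopology ?X ?D). chart_coord d i j A \<in> W}"
    by (rule openin_continuous_map_preimage[OF continuous_map_chart_coord[OF ij]]) (use W in auto)
  then have "openin ?X {A \<in> topspace ?X \<inter> ?D. chart_coord d i j A \<in> W}"
    using openin_open_subtopology[OF D] by (simp add: subtopology_restrict[of ?X ?D])
  then have "openin (subtopology ?X ?F) ({A \<in> topspace ?X \<inter> ?D. chart_coord d i j A \<in> W} \<inter> ?F)"
    by (rule openin_subtopology_Int)
  moreover have "{A \<in> ?F. row_span (d + m) A \<in> {V \<in> chart_domain d m. plane_coord d m i j V \<in> W}} =
      {A \<in> topspace ?X \<inter> ?D. chart_coord d i j A \<in> W} \<inter> ?F"
  proof -
    have "row_span (d + m) A \<in> chart_domain d m \<longleftrightarrow> det (left_block d A) \<noteq> 0"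
      "row_span (d + m) A \<in> chart_domain d m \<Longrightarrow>
       plane_coord d m i j (row_span (d + m) A) = chart_coord d i j A" if "A \<in> ?F" for A
      using row_span_chart_iff[of A d m] plane_coord_row_span[of A d m i j] ij that
      by (auto simp: chart_domain_def full_rank_mats_def)
    then show ?thesis by (auto simp: topspace_mat_topology full_rank_mats_def)
  qed
  ultimately show "openin (subtopology ?X ?F)
      {A \<in> ?F. row_span (d + m) A \<in> {V \<in> chart_domain d m. plane_coord d m i j V \<in> W}}" by simp
qed

lemma chart_domain_subset_topspace:
  assumes "0 < d" "0 < m"
  shows "chart_domain d m \<subseteq> topspace (grassmannian_topology d (d + m))"
  using openin_subset[OF openin_plane_coord_preimage[OF assms open_UNIV]] by simp

lemma continuous_map_plane_coord:
  assumes ij: "i < d" "j < m" and S: "S \<subseteq> chart_domain d m"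
  shows "continuous_map (subtopology (grassmannian_topology d (d + m)) S) euclideanreal (plane_coord d m i j)"
  unfolding continuous_map_def
proof (intro conjI allI impI)
  fix W :: "real set" assume "openin euclideanreal W"
  then have "openin (grassmannian_topology d (d + m)) {V \<in> chart_domain d m. plane_coord d m i j V \<in> W}"
    using openin_plane_coord_preimage[OF ij] by simp
  then have "openin (subtopology (grassmannian_topology d (d + m)) S)
     ({V \<in> chart_domain d m. plane_coord d m i j V \<in> W} \<inter> S)" by (rule openin_subtopology_Int)
  moreover have "chart_domain d m \<subseteq> topspace (grassmannian_topology d (d + m))"
    using chart_domain_subset_topspace ij by auto
  then have "{V \<in> chart_domain d m. plane_coord d m i j V \<in> W} \<inter> S =
     {V \<in> topspace (subtopology (grassmannian_topology d (d + m)) S). plane_coord d m i j V \<in> W}"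
    using S by auto
  ultimately show "openin (subtopology (grassmannian_topology d (d + m)) S)
     {V \<in> topspace (subtopology (grassmannian_topology d (d + m)) S). plane_coord d m i j V \<in> W}" by simp
qed auto

lemma continuous_map_chart:
  assumes ij: "0 < d" "0 < m"
    and C: "\<And>i j. i < d \<Longrightarrow> j < m \<Longrightarrow> continuous_map X euclideanreal (\<lambda>x. C x i j)"
  shows "continuous_map X (grassmannian_topology d (d + m)) (\<lambda>x. row_span (d + m) (chart_mat d m (C x)))"
  unfolding continuous_map_def
proof (intro conjI allI impI)
  have "chart_domain d m \<subseteq> topspace (grassmannian_topology d (d + m))"
    by (rule chart_domain_subset_topspace[OF ij])
  then show "(\<lambda>x. row_span (d + m) (chart_mat d m (C x))) \<in>
     topspace X \<rightarrow> topspace (grassmannian_topology d (d + m))"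
    by (auto simp: chart_domain_def)
  fix U assume "openin (grassmannian_topology d (d + m)) U"
  then have U: "openin (subtopology (mat_topology d (d + m)) (full_rank_mats d (d + m)))
      {A \<in> full_rank_mats d (d + m). row_span (d + m) A \<in> U}"
    by (simp add: openin_grassmannian_topology)
  have "continuous_map X (mat_topology d (d + m)) (\<lambda>x. chart_mat d m (C x))"
  proof (rule continuous_map_into_mat_topology)
    fix i j assume "i < d" "j < d + m"
    then show "continuous_map X euclideanreal (\<lambda>x. chart_mat d m (C x) $$ (i, j))"
      using C[of i "j - d"] by (cases "j < d") (auto simp: chart_mat_def)
  qed simp
  then have "continuous_map X (subtopology (mat_topology d (d + m)) (full_rank_mats d (d + m)))
      (\<lambda>x. chart_mat d m (C x))"
    using chart_mat_full_rank by (auto simp: continuous_map_in_subtopology)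
  from openin_continuous_map_preimage[OF this U]
  show "openin X {x \<in> topspace X. row_span (d + m) (chart_mat d m (C x)) \<in> U}"
    using chart_mat_full_rank by simp
qed

section \<open>The logarithmic parametrization of the cell\<close>

context hook_pattern
begin

text \<open>
  The first column of \<^term>\<open>cell_entries x\<close> has absolute values \<open>exp (x i)\<close> for \<open>i < d\<close>, and its
  first row has absolute values \<open>exp (x (d + j - 1))\<close> for \<open>0 < j < m\<close>.  The shared corner entry
  belongs to the column; dividing by it, i.e. subtracting \<open>x 0\<close>, makes the parametrization bijective
  onto the positive rescalings.
\<close>

definition cell_entries :: "(nat \<Rightarrow> real) \<Rightarrow> nat \<Rightarrow> nat \<Rightarrow> real" where
  "cell_entries x i j = exp (x i) * (if j = 0 then 1 else exp (x (d + j - 1) - x 0)) * C0 i j"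

definition cell_logs :: "real vec set \<Rightarrow> nat \<Rightarrow> real" where
  "cell_logs V k = (if k < d + m - 1
     then ln \<bar>if k < d then plane_coord d m k 0 V else plane_coord d m 0 (k - d + 1) V\<bar> else 0)"

lemma abs_hook: "i < d \<Longrightarrow> \<bar>C0 i 0\<bar> = 1" "j < m \<Longrightarrow> \<bar>C0 0 j\<bar> = 1"
  using entry[of i 0] entry[of 0 j] first_col[of i] first_row[of j] d m by auto

lemma hook_entries_determine:
  assumes eq: "\<And>i j. i < d \<Longrightarrow> j < m \<Longrightarrow> C i j = r i * c j * C0 i j"
    and r: "\<And>i. 0 < r i" and c: "\<And>j. 0 < c j" and ij: "i < d" "j < m"
  shows "C i j = \<bar>C i 0\<bar> * (\<bar>C 0 j\<bar> / \<bar>C 0 0\<bar>) * C0 i j"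
  using eq[OF ij] eq[OF ij(1) m] eq[OF d ij(2)] eq[OF d m] abs_hook(1)[OF ij(1)] abs_hook(2)[OF ij(2)] abs_hook(1)[OF d]
    r[of i] r[of 0] c[of 0] c[of j] by (simp add: abs_mult)

text \<open>
  The maps \<open>x \<mapsto> [(I | cell_entries x)]\<close> and \<^const>\<open>cell_logs\<close> are inverse to each other.  The former is
  continuous because it factors through the space of matrices, the latter because the chart
  coordinates it takes logarithms of are continuous and nonzero on the cell.
\<close>

lemma cell_is_open_cell:
  assumes S: "S = {row_span (d + m) (chart_mat d m (\<lambda>i j. r i * c j * C0 i j)) | r c.
       (\<forall>i. 0 < r i) \<and> (\<forall>j. 0 < c j)}"
  shows "subtopology (grassmannian_topology d (d + m)) S homeomorphic_space Euclidean_space (d + m - 1)"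
proof -
  let ?E = "Euclidean_space (d + m - 1)" and ?G = "subtopology (grassmannian_topology d (d + m)) S"
  let ?f = "\<lambda>x. row_span (d + m) (chart_mat d m (cell_entries x))"
  have SU: "S \<subseteq> chart_domain d m" unfolding S chart_domain_def by auto
  have fS: "?f x \<in> S" for x
  proof -
    let ?r = "\<lambda>i. exp (x i)" and ?c = "\<lambda>j. if j = 0 then 1 else exp (x (d + j - 1) - x 0)"
    have "cell_entries x = (\<lambda>i j. ?r i * ?c j * C0 i j)"
      by (intro ext) (simp add: cell_entries_def)
    then show ?thesis unfolding S by (intro CollectI exI[of _ ?r] exI[of _ ?c]) simp
  qed
  have E: "continuous_map (Euclidean_space N) euclideanreal (\<lambda>x. x k)" for N k
    unfolding Euclidean_space_def
    by (rule continuous_map_from_subtopology) (auto intro: continuous_map_product_projection)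
  have exp: "continuous_map X euclideanreal (\<lambda>x. exp (h x))"
    if "continuous_map X euclideanreal h" for X :: "(nat \<Rightarrow> real) topology" and h
    using continuous_map_compose[OF that, of euclideanreal exp] by (simp add: comp_def continuous_on_exp)
  have "continuous_map ?E (grassmannian_topology d (d + m)) ?f"
  proof (rule continuous_map_chart[OF d m])
    fix i j assume "i < d" "j < m"
    show "continuous_map ?E euclideanreal (\<lambda>x. cell_entries x i j)"
      unfolding cell_entries_def
      by (cases "j = 0") (auto intro!: continuous_map_real_mult exp E continuous_map_diff)
  qed
  then have f: "continuous_map ?E ?G ?f" using fS by (auto simp: continuous_map_in_subtopology)
  have hook: "plane_coord d m i 0 V \<noteq> 0" "plane_coord d m 0 j V \<noteq> 0"
    if VS: "V \<in> S" and ij: "i < d" "j < m" for V i j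
  proof -
    obtain r c where rc: "\<forall>i. 0 < r i" "\<forall>j. 0 < c j"
      and V: "V = row_span (d + m) (chart_mat d m (\<lambda>i j. r i * c j * C0 i j))"
      using VS unfolding S by blast
    have "r i \<noteq> 0" "c j \<noteq> 0" for i j using rc by (metis less_irrefl)+
    then show "plane_coord d m i 0 V \<noteq> 0" "plane_coord d m 0 j V \<noteq> 0"
      using ij d m first_col[of i] first_row[of j] by (simp_all add: V plane_coord_chart)
  qed
  have ln: "continuous_map ?G euclideanreal (\<lambda>V. ln \<bar>h V\<bar>)"
    if h: "continuous_map ?G euclideanreal h" "\<And>V. V \<in> S \<Longrightarrow> h V \<noteq> 0" for h
  proof -
    have "continuous_map ?G (top_of_set (- {0})) h"
      using h by (auto simp: continuous_map_in_subtopology)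
    moreover have "continuous_map (top_of_set (- {0})) euclideanreal (\<lambda>t::real. ln \<bar>t\<bar>)"
      by (auto intro!: continuous_intros)
    ultimately show ?thesis by (rule continuous_map_compose[unfolded comp_def])
  qed
  have "continuous_map ?G ?E (\<lambda>V k. if k < d + m - 1
     then ln \<bar>if k < d then plane_coord d m k 0 V else plane_coord d m 0 (k - d + 1) V\<bar> else 0)"
    unfolding continuous_map_componentwise_Euclidean_space
  proof (intro allI impI)
    fix k assume k: "k < d + m - 1"
    show "continuous_map ?G euclideanreal
       (\<lambda>V. ln \<bar>if k < d then plane_coord d m k 0 V else plane_coord d m 0 (k - d + 1) V\<bar>)"
      using k hook d m
      by (cases "k < d") (auto intro!: ln continuous_map_plane_coord SU)
  qed
  then have g: "continuous_map ?G ?E cell_logs" unfolding cell_logs_def[abs_def] .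
  have gf: "cell_logs (?f x) = x" if "x \<in> topspace ?E" for x
  proof
    fix k
    have "x k = 0" if "\<not> k < d + m - 1" using that \<open>x \<in> topspace ?E\<close> by (simp add: topspace_Euclidean_space)
    moreover have "cell_logs (?f x) k = x k" if k: "k < d + m - 1"
      using k d m abs_hook(1)[of k] abs_hook(1)[OF d] abs_hook(2)[of "k - d + 1"]
      by (auto simp: cell_logs_def plane_coord_chart cell_entries_def abs_mult simp flip: exp_add)
    ultimately show "cell_logs (?f x) k = x k" by (auto simp: cell_logs_def)
  qed
  have fg: "?f (cell_logs V) = V" if V: "V \<in> S" for V
  proof -
    obtain r c where r: "\<And>i. 0 < r i" and c: "\<And>j. 0 < c j"
      and Vrc: "V = row_span (d + m) (chart_mat d m (\<lambda>i j. r i * c j * C0 i j))"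
      using V unfolding S by blast
    define C where "C = (\<lambda>i j. r i * c j * C0 i j)"
    have V': "V = row_span (d + m) (chart_mat d m C)" by (simp add: Vrc C_def)
    have row: "exp (cell_logs V i) = \<bar>C i 0\<bar>" if "i < d" for i
      using that m hook(1)[OF V that m] by (simp add: cell_logs_def V' plane_coord_chart)
    have col: "exp (cell_logs V (d + j - 1)) = \<bar>C 0 j\<bar>" if "j < m" "j \<noteq> 0" for j
    proof -
      have "\<not> d + j - 1 < d" "d + j - 1 < d + m - 1" "d + j - 1 - d + 1 = j" using that d by arith+
      then show ?thesis
        using that(1) d hook(2)[OF V d that(1)] unfolding cell_logs_def V' by (simp add: plane_coord_chart)
    qed
    have "cell_entries (cell_logs V) i j = C i j" if ij: "i < d" "j < m" for i j
    proof -
      have "C i j = \<bar>C i 0\<bar> * (\<bar>C 0 j\<bar> / \<bar>C 0 0\<bar>) * C0 i j"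
        by (rule hook_entries_determine[where r = r and c = c, OF _ r c ij]) (simp add: C_def)
      moreover have "C 0 0 \<noteq> 0" using hook(1)[OF V d m] d m by (simp add: V' plane_coord_chart)
      ultimately show ?thesis using row[OF ij(1)] row[OF d] col[OF ij(2)]
        by (cases "j = 0") (simp_all add: cell_entries_def exp_diff)
    qed
    then have "chart_mat d m (cell_entries (cell_logs V)) = chart_mat d m C"
      by (intro eq_matI) (auto simp: chart_mat_def)
    then show ?thesis using V' by simp
  qed
  have "homeomorphic_maps ?G ?E cell_logs ?f"
    unfolding homeomorphic_maps_def using f g gf fg by auto
  then show ?thesis by (rule homeomorphic_maps_imp_homeomorphic_space)
qed
end

theorem corollary5p6:
  fixes d m :: nat and P :: matroid
  assumes "0 < d" and "0 < m"
    and "rational_dyck_positroid d m P"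
  shows "open_cell_of_dim (d + m - 1)
           (subtopology (nonneg_grassmannian_topology d (d + m)) (positroid_cell d (d + m) P))"
proof -
  obtain A where A: "A \<in> rational_dyck_matrices d m" "P = represented_matroid (phi d m A)"
    and pos: "positroid d (d + m) P"
    using assms(3) unfolding rational_dyck_positroid_def by blast
  interpret hook_pattern d m "phi_block d A" by (rule hook_pattern_phi_block[OF A(1) assms(1,2)])
  have "positroid_cell d (d + m) P \<subseteq> nonneg_grassmannian d (d + m)"
    by (simp add: positroid_cell_def)
  then have "subtopology (nonneg_grassmannian_topology d (d + m)) (positroid_cell d (d + m) P) =
      subtopology (grassmannian_topology d (d + m)) (positroid_cell d (d + m) P)"
    unfolding nonneg_grassmannian_topology_def subtopology_subtopology by (simp add: Int_absorb1)
  then show ?thesis unfolding open_cell_of_dim_def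
    using cell_is_open_cell[OF positroid_cell_eq[OF _ pos]] A(2) by (simp add: phi_eq_chart_mat)
qed

end
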